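(* Let $\Pi\subset\mathbb R^2$ be a convex polygon with vertex set $V=\{\mathbf v_1,\dots,\mathbf v_n\}$ ($n\ge3$, counterclockwise, all extreme points), and let $\delta$ be a chordal decomposition of $\Pi$. Define $\kappa\colon\Pi\times V\to\mathbb R$ by $$\langle a|v\rangle_\kappa=\frac1{2n}\sum_{g\in D_n}\langle a|v\rangle_{\delta g}.$$ Then $\kappa$ is a coordinate system on $\Pi$: for every $a\in\Pi$ the values $\langle a|v\rangle_\kappa$ lie in $[0,1]$ and $a=\sum_{v\in V}\langle a|v\rangle_\kappa\,v$ is a convex combination.
   Context: A chord is a segment joining two non-adjacent vertices of $\Pi$. A chordal decomposition $\delta$ is a set of $n-3$ pairwise non-crossing chords; they decompose $\Pi$ into $n-2$ closed triangles with vertices among $V$, forming the set $T_\delta$. For a triangle $\tau$ with counterclockwise vertices $u_0,u_1,u_2$ (indices mod 3), $\langle x|u_i\rangle_\tau=A(u_{i-1},x,u_{i+1})/A(u_0,u_1,u_2)$, with $A(\mathbf p,\mathbf q,\mathbf r)=\tfrac12\det[\mathbf q-\mathbf p,\mathbf r-\mathbf p]$. Chordal coordinates: for a vertex $v$, let $\tau_1,\dots,\tau_r$ enumerate the triangles of $T_\delta$ containing $v$; $F_0=0$, $F_k=F_{k-1}+\mathds 1_{\tau_k}\langle\cdot|v\rangle_{\tau_k}-\mathds 1_{\tau_k\cap(\tau_1\cup\dots\cup\tau_{k-1})}\langle\cdot|v\rangle_{\tau_k}$, and $\langle a|v\rangle_\delta=F_r(a)$ ($\mathds 1_X$ the indicator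 of $X$). The dihedral group $D_n$ of order $2n$ is the automorphism group of the cycle graph on $\{1,\dots,n\}$ (generated by $i\mapsto i+1$ and $i\mapsto -i$ modulo $n$); it acts on chords by $\{\mathbf v_i,\mathbf v_j\}\mapsto\{\mathbf v_{ig},\mathbf v_{jg}\}$ (the vertex positions being fixed), and $\delta g$ denotes the image chordal decomposition. *)

theory Defs
  imports "HOL-Analysis.Analysis"
begin

type_synonym pt = "real \<times> real"

definition area :: "pt \<Rightarrow> pt \<Rightarrow> pt \<Rightarrow> real" where
  "area p q r = ((fst q - fst p) * (snd r - snd p) - (snd q - snd p) * (fst r - fst p)) / 2"

text \<open>Vertices are p 0, ..., p (n-1), listed counterclockwise, in strictly convex position
  (every vertex is an extreme point): every triple in cyclic order is positively oriented.\<close>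
definition convex_polygon :: "(nat \<Rightarrow> pt) \<Rightarrow> nat \<Rightarrow> bool" where
  "convex_polygon p n \<longleftrightarrow> 3 \<le> n \<and> (\<forall>i j k. i < j \<and> j < k \<and> k < n \<longrightarrow> area (p i) (p j) (p k) > 0)"

definition polygon :: "(nat \<Rightarrow> pt) \<Rightarrow> nat \<Rightarrow> pt set" where
  "polygon p n = convex hull (p ` {..<n})"

definition cyc_adj :: "nat \<Rightarrow> nat \<Rightarrow> nat \<Rightarrow> bool" where
  "cyc_adj n i j \<longleftrightarrow> j = (i + 1) mod n \<or> i = (j + 1) mod n"

definition is_edge :: "nat \<Rightarrow> nat set \<Rightarrow> bool" where
  "is_edge n e \<longleftrightarrow> (\<exists>i j. e = {i, j} \<and> i < n \<and> j < n \<and> i \<noteq> j \<and> cyc_adj n i j)"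

definition is_chord :: "nat \<Rightarrow> nat set \<Rightarrow> bool" where
  "is_chord n c \<longleftrightarrow> (\<exists>i j. c = {i, j} \<and> i < n \<and> j < n \<and> i \<noteq> j \<and> \<not> cyc_adj n i j)"

definition seg :: "(nat \<Rightarrow> pt) \<Rightarrow> nat set \<Rightarrow> pt set" where
  "seg p c = convex hull (p ` c)"

definition non_crossing :: "(nat \<Rightarrow> pt) \<Rightarrow> nat set \<Rightarrow> nat set \<Rightarrow> bool" where
  "non_crossing p c1 c2 \<longleftrightarrow> seg p c1 \<inter> seg p c2 \<subseteq> p ` c1 \<inter> p ` c2"

definition chordal_decomp :: "(nat \<Rightarrow> pt) \<Rightarrow> nat \<Rightarrow> nat set set \<Rightarrow> bool" where
  "chordal_decomp p n \<delta> \<longleftrightarrow> (\<forall>c\<in>\<delta>. is_chord n c) \<and> finite \<delta> \<and> card \<delta> = n - 3 \<and>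
     (\<forall>c1\<in>\<delta>. \<forall>c2\<in>\<delta>. c1 \<noteq> c2 \<longrightarrow> non_crossing p c1 c2)"

definition triangles :: "nat \<Rightarrow> nat set set \<Rightarrow> nat set set" where
  "triangles n \<delta> = {t. t \<subseteq> {..<n} \<and> card t = 3 \<and>
      (\<forall>e. e \<subseteq> t \<and> card e = 2 \<longrightarrow> e \<in> \<delta> \<or> is_edge n e)}"

definition tri :: "(nat \<Rightarrow> pt) \<Rightarrow> nat set \<Rightarrow> pt set" where
  "tri p t = convex hull (p ` t)"

text \<open>Barycentric coordinate of x with respect to the vertex p v of triangle t; the
  vertices of t sorted by index, u0 u1 u2, are in counterclockwise order.\<close>
definition bary :: "(nat \<Rightarrow> pt) \<Rightarrow> nat set \<Rightarrow> nat \<Rightarrow> pt \<Rightarrow> real" where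
  "bary p t v x = (let l = sorted_list_of_set t; u0 = p (l!0); u1 = p (l!1); u2 = p (l!2);
                       D = area u0 u1 u2 in
     if v = l!0 then area u2 x u1 / D
     else if v = l!1 then area u0 x u2 / D
     else if v = l!2 then area u1 x u0 / D else 0)"

text \<open>F_k recursion: U is the union tau_1 \<union> ... \<union> tau_(k-1) of the already processed triangles.\<close>
fun chordF :: "(nat \<Rightarrow> pt) \<Rightarrow> nat \<Rightarrow> pt set \<Rightarrow> nat set list \<Rightarrow> pt \<Rightarrow> real" where
  "chordF p v U [] x = 0"
| "chordF p v U (t # ts) x =
     indicator (tri p t) x * bary p t v x - indicator (tri p t \<inter> U) x * bary p t v x
     + chordF p v (U \<union> tri p t) ts x"

definition chordal_coord :: "(nat \<Rightarrow> pt) \<Rightarrow> nat \<Rightarrow> nat set set \<Rightarrow> pt \<Rightarrow> nat \<Rightarrow> real" where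
  "chordal_coord p n \<delta> a v =
     (let ts = (SOME ts. distinct ts \<and> set ts = {t \<in> triangles n \<delta>. v \<in> t}) in chordF p v {} ts a)"

text \<open>Dihedral group D_n: automorphisms of the cycle graph on {0..<n} (extensional functions).\<close>
definition dihedral :: "nat \<Rightarrow> (nat \<Rightarrow> nat) set" where
  "dihedral n = {g. g \<in> extensional {..<n} \<and> bij_betw g {..<n} {..<n} \<and>
      (\<forall>i<n. \<forall>j<n. cyc_adj n i j \<longleftrightarrow> cyc_adj n (g i) (g j))}"

definition act :: "nat set set \<Rightarrow> (nat \<Rightarrow> nat) \<Rightarrow> nat set set" where
  "act \<delta> g = (\<lambda>c. g ` c) ` \<delta>"

definition kappa :: "(nat \<Rightarrow> pt) \<Rightarrow> nat \<Rightarrow> nat set set \<Rightarrow> pt \<Rightarrow> nat \<Rightarrow> real" where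
  "kappa p n \<delta> a v = (1 / (2 * real n)) * (\<Sum>g\<in>dihedral n. chordal_coord p n (act \<delta> g) a v)"

end

theory Submission
  imports Defs
begin

text \<open>Non-crossing only depends on the cyclic order of the vertices, so it survives the action of
  \<^term>\<open>dihedral n\<close>, which consists of the \<^term>\<open>n\<close> rotations and \<^term>\<open>n\<close> reflections. It thus
  suffices to treat one decomposition. Cutting along a chord and inducting on the number of vertices
  shows at once that a non-crossing set has at most \<^term>\<open>n - 3\<close> chords and that, in case of equality,
  its triangles cover the polygon. Two distinct triangles are separated by a side of one of them, so
  a common point lies on that side and has the same barycentric coordinates in both. Hence the
  inclusion-exclusion formula collapses to the barycentric coordinate in any triangle containing
  the point, and averaging preserves convex combinations.\<close>

section \<open>Convex weights and crossing diagonals\<close>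

text \<open>Strict interleaving of the endpoints is the index form of two diagonals meeting in their
  interiors. \<open>min\<close> and \<open>max\<close> make it independent of the order in which a
  chord is written; chords sharing an endpoint never cross.\<close>

definition crosses :: "nat \<Rightarrow> nat \<Rightarrow> nat \<Rightarrow> nat \<Rightarrow> bool" where
  "crosses a b c d \<longleftrightarrow>
     (min a b < c \<and> c < max a b \<and> (d < min a b \<or> max a b < d)) \<or>
     (min a b < d \<and> d < max a b \<and> (c < min a b \<or> max a b < c))"

text \<open>Dihedral maps permute indices while the vertex positions stay fixed, so they need not
  come from a symmetry of the plane. This index-only form is the one that can be
  transported.\<close>

definition noncrossing_decomp :: "nat \<Rightarrow> nat set set \<Rightarrow> bool" where
  "noncrossing_decomp n \<delta> \<longleftrightarrow> (\<forall>c\<in>\<delta>. is_chord n c) \<and> finite \<delta> \<and> card \<delta> = n - 3 \<and>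
     (\<forall>a b c d. {a, b} \<in> \<delta> \<and> {c, d} \<in> \<delta> \<longrightarrow> \<not> crosses a b c d)"

text \<open>Vanishing off \<open>S\<close> makes weights total functions, so weights of one point
  over different vertex sets can be compared by plain equality.\<close>

definition convex_weights :: "(nat \<Rightarrow> pt) \<Rightarrow> nat set \<Rightarrow> pt \<Rightarrow> (nat \<Rightarrow> real) \<Rightarrow> bool" where
  "convex_weights p S a w \<longleftrightarrow> (\<forall>s. 0 \<le> w s) \<and> (\<forall>s. s \<notin> S \<longrightarrow> w s = 0) \<and>
     sum w S = 1 \<and> (\<Sum>s\<in>S. w s *\<^sub>R p s) = a"

lemma convex_weights_mono:
  assumes "convex_weights p S a w" "S \<subseteq> T" "finite T"
  shows "convex_weights p T a w"
proof -
  have "sum w T = sum w S"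
    using assms by (intro sum.mono_neutral_right) (auto simp: convex_weights_def)
  moreover have "(\<Sum>s\<in>T. w s *\<^sub>R p s) = (\<Sum>s\<in>S. w s *\<^sub>R p s)"
    using assms by (intro sum.mono_neutral_right) (auto simp: convex_weights_def)
  ultimately show ?thesis
    using assms by (auto simp: convex_weights_def)
qed

lemma convex_weights_restrict:
  assumes "convex_weights p T a w" "S \<subseteq> T" "finite T" "\<And>s. s \<in> T - S \<Longrightarrow> w s = 0"
  shows "convex_weights p S a w"
proof -
  have "sum w T = sum w S"
    using assms by (intro sum.mono_neutral_right) (auto simp: convex_weights_def)
  moreover have "(\<Sum>s\<in>T. w s *\<^sub>R p s) = (\<Sum>s\<in>S. w s *\<^sub>R p s)"
    using assms by (intro sum.mono_neutral_right) (auto simp: convex_weights_def)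
  ultimately show ?thesis
    using assms by (auto simp: convex_weights_def)
qed

lemma convex_weights_le_1:
  assumes "convex_weights p S a w" "finite S"
  shows "w s \<le> 1"
proof (cases "s \<in> S")
  case True
  then have "w s \<le> sum w S"
    using assms by (intro member_le_sum) (auto simp: convex_weights_def)
  then show ?thesis using assms by (simp add: convex_weights_def)
qed (use assms in \<open>auto simp: convex_weights_def\<close>)

lemma hull_iff_convex_weights:
  assumes "finite S" "inj_on p S"
  shows "a \<in> convex hull (p ` S) \<longleftrightarrow> (\<exists>w. convex_weights p S a w)"
proof
  assume "a \<in> convex hull (p ` S)"
  then obtain u where u: "\<forall>x\<in>p ` S. 0 \<le> u x" "sum u (p ` S) = 1" "(\<Sum>x\<in>p ` S. u x *\<^sub>R x) = a"
    using assms(1) by (auto simp: convex_hull_finite)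
  let ?w = "\<lambda>s. if s \<in> S then u (p s) else 0"
  have "sum ?w S = 1" "(\<Sum>s\<in>S. ?w s *\<^sub>R p s) = a"
    using u assms(2) by (simp_all add: sum.reindex)
  then have "convex_weights p S a ?w"
    using u(1) unfolding convex_weights_def by auto
  then show "\<exists>w. convex_weights p S a w" by blast
next
  assume "\<exists>w. convex_weights p S a w"
  then obtain w where w: "convex_weights p S a w" ..
  let ?u = "\<lambda>x. w (the_inv_into S p x)"
  have "sum ?u (p ` S) = 1" "(\<Sum>x\<in>p ` S. ?u x *\<^sub>R x) = a"
    using w assms(2) by (simp_all add: sum.reindex the_inv_into_f_f convex_weights_def)
  then show "a \<in> convex hull (p ` S)"
    using w unfolding convex_hull_finite[OF finite_imageI[OF assms(1)]]
    by (intro CollectI exI[of _ ?u]) (auto simp: convex_weights_def)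
qed

lemma convex_polygonD:
  "convex_polygon p n \<Longrightarrow> i < j \<Longrightarrow> j < k \<Longrightarrow> k < n \<Longrightarrow> 0 < area (p i) (p j) (p k)"
  by (auto simp: convex_polygon_def)

lemma area_swap: "area a c b = - area a b c"
  by (simp add: area_def field_simps)

text \<open>As \<open>n\<close> is at least 3, two indices extend to a triple, and coinciding
  vertices would give that triple area zero.\<close>

lemma convex_polygon_inj:
  assumes "convex_polygon p n"
  shows "inj_on p {..<n}"
proof -
  have "p i \<noteq> p j" if "i < j" "j < n" for i j
  proof -
    have "\<exists>k<n. k \<noteq> i \<and> k \<noteq> j"
    proof -
      have "card {..<n} > card {i, j}"
        using assms that by (simp add: convex_polygon_def)
      then have "\<not> {..<n} \<subseteq> {i, j}"
        by (metis card_mono finite.emptyI finite.insertI leD)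
      then show ?thesis by auto
    qed
    then obtain k where k: "k < n" "k \<noteq> i" "k \<noteq> j" by auto
    then consider "k < i" | "i < k" "k < j" | "j < k" by linarith
    then show ?thesis
      using convex_polygonD[OF assms, of k i j] convex_polygonD[OF assms, of i k j]
        convex_polygonD[OF assms, of i j k] that k
      by cases (auto simp: area_def)
  qed
  then show ?thesis
    unfolding inj_on_def by (metis lessThan_iff linorder_neqE_nat)
qed

text \<open>The coefficient of each vertex is the area of the triangle on the other three (Cramer's
  rule), positive by convexity. Both sides of \<open>\<alpha> + \<beta> = \<gamma> + \<eta>\<close>
  are the area of the quadrilateral, cut along one diagonal or the other.\<close>

lemma convex_polygon_diagonals_meet:
  assumes "convex_polygon p n" "i < k" "k < j" "j < l" "l < n"
  obtains \<alpha> \<beta> \<gamma> \<eta> :: real where "\<alpha> > 0" "\<beta> > 0" "\<gamma> > 0" "\<eta> > 0" "\<alpha> + \<beta> = \<gamma> + \<eta>"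
    "\<alpha> *\<^sub>R p i + \<beta> *\<^sub>R p j = \<gamma> *\<^sub>R p k + \<eta> *\<^sub>R p l"
proof
  show "area (p k) (p j) (p l) > 0" "area (p i) (p k) (p l) > 0" "area (p i) (p j) (p l) > 0"
    "area (p i) (p k) (p j) > 0"
    using assms convex_polygonD[OF assms(1)] by auto
  show "area (p k) (p j) (p l) + area (p i) (p k) (p l) = area (p i) (p j) (p l) + area (p i) (p k) (p j)"
    by (simp add: area_def field_simps)
  show "area (p k) (p j) (p l) *\<^sub>R p i + area (p i) (p k) (p l) *\<^sub>R p j =
      area (p i) (p j) (p l) *\<^sub>R p k + area (p i) (p k) (p j) *\<^sub>R p l"
    by (simp add: area_def field_simps prod_eq_iff)
qed

text \<open>Interleaved chords have a common point by \<open>convex_polygon_diagonals_meet\<close>.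
  Geometric non-crossing makes it a common endpoint, which four distinct indices and injectivity of
  \<open>p\<close> rule out.\<close>

lemma noncrossing_decomp_if_chordal_decomp:
  assumes poly: "convex_polygon p n" and "chordal_decomp p n \<delta>"
  shows "noncrossing_decomp n \<delta>"
proof -
  have key: False if "{i, j} \<in> \<delta>" "{k, l} \<in> \<delta>" "i < k" "k < j" "j < l" for i j k l
  proof -
    have ln: "l < n"
      using assms(2) that(2) by (fastforce simp: chordal_decomp_def is_chord_def doubleton_eq_iff)
    obtain \<alpha> \<beta> \<gamma> \<eta> :: real where pos: "\<alpha> > 0" "\<beta> > 0" "\<gamma> > 0" "\<eta> > 0" "\<alpha> + \<beta> = \<gamma> + \<eta>"
      and eq: "\<alpha> *\<^sub>R p i + \<beta> *\<^sub>R p j = \<gamma> *\<^sub>R p k + \<eta> *\<^sub>R p l"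
      using convex_polygon_diagonals_meet[OF poly \<open>i < k\<close> \<open>k < j\<close> \<open>j < l\<close> ln] by metis
    let ?s = "\<alpha> + \<beta>"
    \<comment> \<open>Both sides of \<open>eq\<close> have the same total weight, so one
      normalisation yields a convex combination on each chord.\<close>
    define z where "z = (1 / ?s) *\<^sub>R (\<alpha> *\<^sub>R p i + \<beta> *\<^sub>R p j)"
    have "z = (\<alpha> / ?s) *\<^sub>R p i + (\<beta> / ?s) *\<^sub>R p j" "\<alpha> / ?s + \<beta> / ?s = 1"
      using pos by (simp_all add: z_def scaleR_add_right add_divide_distrib[symmetric])
    then have z1: "z \<in> seg p {i, j}"
      using pos unfolding seg_def image_insert image_empty convex_hull_2
      by (intro CollectI exI[of _ "\<alpha> / ?s"] exI[of _ "\<beta> / ?s"]) simp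
    have "z = (\<gamma> / ?s) *\<^sub>R p k + (\<eta> / ?s) *\<^sub>R p l" "\<gamma> / ?s + \<eta> / ?s = 1"
      using pos eq by (simp_all add: z_def scaleR_add_right add_divide_distrib[symmetric])
    then have z2: "z \<in> seg p {k, l}"
      using pos unfolding seg_def image_insert image_empty convex_hull_2
      by (intro CollectI exI[of _ "\<gamma> / ?s"] exI[of _ "\<eta> / ?s"]) simp
    have "{i, j} \<noteq> {k, l}" using that by auto
    then have "non_crossing p {i, j} {k, l}"
      using assms(2) that(1,2) by (simp add: chordal_decomp_def)
    then have "z \<in> p ` {i, j} \<inter> p ` {k, l}"
      using z1 z2 unfolding non_crossing_def by (meson IntI subsetD)
    then show False
      using convex_polygon_inj[OF poly] that ln by (auto dest: inj_onD)
  qed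
  have "\<not> crosses a b c d" if "{a, b} \<in> \<delta>" "{c, d} \<in> \<delta>" for a b c d
  proof
    \<comment> \<open>\<open>key\<close> treats one interleaving order; the others arise by
      reversing either chord or exchanging the two.\<close>
    have sym: "{b, a} \<in> \<delta>" "{d, c} \<in> \<delta>"
      using that by (simp_all add: insert_commute)
    assume "crosses a b c d"
    then show False
      unfolding crosses_def min_def max_def
      using key[OF that] key[OF that(2,1)] key[OF sym] key[OF sym(2,1)]
        key[OF that(1) sym(2)] key[OF sym(2) that(1)] key[OF sym(1) that(2)] key[OF that(2) sym(1)]
      by (auto split: if_splits)
  qed
  then show ?thesis
    using assms(2) by (auto simp: noncrossing_decomp_def chordal_decomp_def)
qed

text \<open>As long as both sides carry weight, two weights on opposite sides of the diagonal can be
  traded for weight on its endpoints until one of them vanishes.\<close>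

lemma convex_weights_split:
  assumes poly: "convex_polygon p n" and S: "S \<subseteq> {..<n}" and ij: "i \<in> S" "j \<in> S" "i < j"
    and "convex_weights p S a w"
  shows "\<exists>w'. convex_weights p {s \<in> S. i \<le> s \<and> s \<le> j} a w' \<or>
              convex_weights p {s \<in> S. s \<le> i \<or> j \<le> s} a w'"
  using assms(6)
\<comment> \<open>\<open>i\<close> and \<open>j\<close> are left out of the count because they
  receive the traded weight.\<close>
proof (induction "card {s \<in> S - {i, j}. w s \<noteq> 0}" arbitrary: w rule: less_induct)
  case less
  have fin: "finite S" using S finite_subset by blast
  note w = less.prems
  show ?case
  proof (cases "\<exists>s\<in>S. \<exists>r\<in>S. i < s \<and> s < j \<and> (r < i \<or> j < r) \<and> w s \<noteq> 0 \<and> w r \<noteq> 0")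
    case False
    then consider "\<forall>s\<in>S. i < s \<and> s < j \<longrightarrow> w s = 0" | "\<forall>s\<in>S. s < i \<or> j < s \<longrightarrow> w s = 0" by blast
    then show ?thesis
    proof cases
      case 1
      then have "convex_weights p {s \<in> S. s \<le> i \<or> j \<le> s} a w"
        by (intro convex_weights_restrict[OF w _ fin]) auto
      then show ?thesis by blast
    next
      case 2
      then have "convex_weights p {s \<in> S. i \<le> s \<and> s \<le> j} a w"
        by (intro convex_weights_restrict[OF w _ fin]) auto
      then show ?thesis by blast
    qed
  next
    case True
    then obtain s r where sr: "s \<in> S" "r \<in> S" "i < s" "s < j" "r < i \<or> j < r" "w s \<noteq> 0" "w r \<noteq> 0"
      by blast
    have lt: "r < n" "j < n" using S sr ij by auto
    obtain \<alpha> \<beta> \<gamma> \<eta> :: real where pos: "\<alpha> > 0" "\<beta> > 0" "\<gamma> > 0" "\<eta> > 0" "\<alpha> + \<beta> = \<gamma> + \<eta>"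
      and eq: "\<alpha> *\<^sub>R p s + \<beta> *\<^sub>R p r = \<gamma> *\<^sub>R p i + \<eta> *\<^sub>R p j"
    \<comment> \<open>The index order is r, i, s, j or i, s, j, r, which decides the role of the
      diagonal from \<open>i\<close> to \<open>j\<close> in
      \<open>convex_polygon_diagonals_meet\<close>.\<close>
    proof (cases "r < i")
      case True
      obtain \<alpha> \<beta> \<gamma> \<eta> :: real where "\<alpha> > 0" "\<beta> > 0" "\<gamma> > 0" "\<eta> > 0" "\<alpha> + \<beta> = \<gamma> + \<eta>"
        "\<alpha> *\<^sub>R p r + \<beta> *\<^sub>R p s = \<gamma> *\<^sub>R p i + \<eta> *\<^sub>R p j"
        using convex_polygon_diagonals_meet[OF poly True sr(3,4) lt(2)] by metis
      then show thesis using that[of \<beta> \<alpha> \<gamma> \<eta>] by (simp add: add.commute)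
    next
      case False
      then have "j < r" using sr by simp
      then obtain \<alpha> \<beta> \<gamma> \<eta> :: real where "\<alpha> > 0" "\<beta> > 0" "\<gamma> > 0" "\<eta> > 0" "\<alpha> + \<beta> = \<gamma> + \<eta>"
        "\<alpha> *\<^sub>R p i + \<beta> *\<^sub>R p j = \<gamma> *\<^sub>R p s + \<eta> *\<^sub>R p r"
        using convex_polygon_diagonals_meet[OF poly sr(3,4) _ lt(1)] by metis
      then show thesis using that[of \<gamma> \<eta> \<alpha> \<beta>] by simp
    qed
    have wpos: "w s > 0" "w r > 0" "\<forall>v. 0 \<le> w v"
      using w sr unfolding convex_weights_def by (auto simp: order_less_le)
    \<comment> \<open>The largest step that keeps both donors nonnegative; it empties at least one
      of them.\<close>
    define \<epsilon> where "\<epsilon> = min (w s / \<alpha>) (w r / \<beta>)"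
    have eps: "0 < \<epsilon>" "\<epsilon> * \<alpha> \<le> w s" "\<epsilon> * \<beta> \<le> w r" "\<epsilon> * \<alpha> = w s \<or> \<epsilon> * \<beta> = w r"
      using wpos pos by (auto simp: \<epsilon>_def min_def field_simps)
    define h where "h v = (if v = s then - \<alpha> else if v = r then - \<beta> else if v = i then \<gamma>
        else if v = j then \<eta> else 0)" for v
    define w' where "w' v = w v + \<epsilon> * h v" for v
    have dist: "s \<noteq> r" "s \<noteq> i" "s \<noteq> j" "r \<noteq> i" "r \<noteq> j" "i \<noteq> j" using sr ij by auto
    have hs: "h s = - \<alpha>" "h r = - \<beta>" "h i = \<gamma>" "h j = \<eta>" using dist by (auto simp: h_def)
    have sub: "{s, r, i, j} \<subseteq> S" using sr ij by auto
    have h0: "h v = 0" if "v \<notin> {s, r, i, j}" for v using that by (auto simp: h_def)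
    have "sum h S = sum h {s, r, i, j}"
      using fin sub h0 by (intro sum.mono_neutral_right) auto
    also have "\<dots> = 0" using dist hs pos(5) by simp
    finally have sum_h: "sum h S = 0" .
    have "(\<Sum>v\<in>S. h v *\<^sub>R p v) = (\<Sum>v\<in>{s, r, i, j}. h v *\<^sub>R p v)"
      using fin sub h0 by (intro sum.mono_neutral_right) auto
    also have "\<dots> = (\<gamma> *\<^sub>R p i + \<eta> *\<^sub>R p j) - (\<alpha> *\<^sub>R p s + \<beta> *\<^sub>R p r)"
      using dist hs by simp
    finally have sum_hp: "(\<Sum>v\<in>S. h v *\<^sub>R p v) = 0" using eq by simp
    have "convex_weights p S a w'"
      unfolding convex_weights_def
    proof (intro conjI allI impI)
      fix v
      show "0 \<le> w' v"
        using wpos(3) eps pos unfolding w'_def h_def by (auto simp: algebra_simps)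
      show "w' v = 0" if "v \<notin> S"
        using that w sub h0[of v] by (auto simp: w'_def convex_weights_def)
      show "sum w' S = 1"
        using w sum_h by (simp add: w'_def sum.distrib sum_distrib_left[symmetric] convex_weights_def)
      have "(\<Sum>v\<in>S. w' v *\<^sub>R p v) = (\<Sum>v\<in>S. w v *\<^sub>R p v) + \<epsilon> *\<^sub>R (\<Sum>v\<in>S. h v *\<^sub>R p v)"
        by (simp add: w'_def scaleR_add_left sum.distrib scaleR_sum_right)
      then show "(\<Sum>v\<in>S. w' v *\<^sub>R p v) = a"
        using w sum_hp by (simp add: convex_weights_def)
    qed
    moreover have "card {v \<in> S - {i, j}. w' v \<noteq> 0} < card {v \<in> S - {i, j}. w v \<noteq> 0}"
    proof (rule psubset_card_mono)
      have "w' v = 0" if "v \<notin> {i, j}" "w v = 0" for v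
        using that sr h0[of v] by (auto simp: w'_def)
      moreover have "w' s = 0 \<or> w' r = 0" using eps hs by (auto simp: w'_def)
      ultimately show "{v \<in> S - {i, j}. w' v \<noteq> 0} \<subset> {v \<in> S - {i, j}. w v \<noteq> 0}"
        using sr dist by blast
    qed (use fin in auto)
    ultimately show ?thesis using less.hyps by blast
  qed
qed

section \<open>Triangulations cover the polygon\<close>

text \<open>\<open>S\<close> is the vertex set of a sub-polygon and need not be an interval, so
  being no side of it is expressed by vertices of \<open>S\<close> strictly on both sides of the
  pair.\<close>

definition diagonals :: "nat set \<Rightarrow> (nat \<times> nat) set" where
  "diagonals S = {(a, b). a \<in> S \<and> b \<in> S \<and> a < b \<and> (\<exists>x\<in>S. a < x \<and> x < b) \<and> (\<exists>x\<in>S. x < a \<or> b < x)}"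

lemma card_3_sorted:
  fixes S :: "nat set"
  assumes "card S = 3"
  obtains i j k where "S = {i, j, k}" "i < j" "j < k"
proof -
  obtain x y z where xyz: "S = {x, y, z}" "x \<noteq> y" "y \<noteq> z" "x \<noteq> z"
    using assms by (auto simp: card_3_iff)
  have "\<exists>i j k. S = {i, j, k} \<and> i < j \<and> j < k"
  proof (rule ccontr)
    assume c: "\<nexists>i j k. S = {i, j, k} \<and> i < j \<and> j < k"
    have "S = {x, z, y}" "S = {y, x, z}" "S = {y, z, x}" "S = {z, x, y}" "S = {z, y, x}"
      using xyz(1) by auto
    with c xyz show False by (metis linorder_neqE_nat)
  qed
  then show thesis using that by blast
qed

text \<open>Bound and covering share one induction, because the bounds for the two halves turn
  equality for \<open>S\<close> into equality for each half. A triangle side that is no diagonal of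
  \<open>S\<close> is a side of the sub-polygon, so only diagonals are required to lie in
  \<open>D\<close>.\<close>

lemma noncrossing_diagonals_cover:
  assumes poly: "convex_polygon p n"
  assumes "S \<subseteq> {..<n}" "3 \<le> card S" "D \<subseteq> diagonals S"
    "\<And>a b c d. (a, b) \<in> D \<Longrightarrow> (c, d) \<in> D \<Longrightarrow> \<not> crosses a b c d"
  shows "card D + 3 \<le> card S \<and>
    (card D + 3 = card S \<longrightarrow> convex_weights p S a w \<longrightarrow>
      (\<exists>i j k w'. i < j \<and> j < k \<and> {i, j, k} \<subseteq> S \<and> convex_weights p {i, j, k} a w' \<and>
         {(i, j), (j, k), (i, k)} \<inter> diagonals S \<subseteq> D))"
  using assms(2-)
proof (induction "card S" arbitrary: S D w rule: less_induct)
  case less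
  have fin: "finite S" using less.prems(1) finite_subset by blast
  have finD: "finite D"
    by (rule finite_subset[OF less.prems(3)], rule finite_subset[of _ "S \<times> S"])
       (use fin in \<open>auto simp: diagonals_def\<close>)
  show ?case
  proof (cases "D = {}")
    case True
    have "\<exists>i j k w'. i < j \<and> j < k \<and> {i, j, k} \<subseteq> S \<and> convex_weights p {i, j, k} a w' \<and>
         {(i, j), (j, k), (i, k)} \<inter> diagonals S \<subseteq> D"
      if c3: "card S = 3" and w: "convex_weights p S a w"
    proof -
      obtain i j k where S: "S = {i, j, k}" "i < j" "j < k"
        using card_3_sorted[OF c3] by metis
      moreover have "diagonals S = {}" using S by (auto simp: diagonals_def)
      ultimately show ?thesis using w by blast
    qed
    then show ?thesis using True less.prems(2) by simp
  next
    case False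
    then obtain i j where ij: "(i, j) \<in> D" by (metis ex_in_conv surj_pair)
    then have ijS: "i \<in> S" "j \<in> S" "i < j" and ex: "\<exists>x\<in>S. i < x \<and> x < j" "\<exists>x\<in>S. x < i \<or> j < x"
      using less.prems(3) by (auto simp: diagonals_def)
    \<comment> \<open>Cut along a member of \<open>D\<close>. The halves share exactly
      \<open>i\<close> and \<open>j\<close>, whence the summand 2 in \<open>cS\<close>.\<close>
    define S1 where "S1 = {s \<in> S. i \<le> s \<and> s \<le> j}"
    define S2 where "S2 = {s \<in> S. s \<le> i \<or> j \<le> s}"
    define D1 where "D1 = D \<inter> diagonals S1"
    define D2 where "D2 = D \<inter> diagonals S2"
    have finS: "finite S1" "finite S2" using fin by (auto simp: S1_def S2_def)
    have "S1 \<union> S2 = S" "S1 \<inter> S2 = {i, j}" using ijS by (auto simp: S1_def S2_def)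
    then have cS: "card S1 + card S2 = card S + 2"
      using card_Un_Int[OF finS] ijS by simp
    obtain x y where xy: "x \<in> S" "i < x" "x < j" "y \<in> S" "y < i \<or> j < y" using ex by blast
    have "card {i, x, j} \<le> card S1" "card {i, y, j} \<le> card S2"
      by (rule card_mono; use finS xy ijS in \<open>auto simp: S1_def S2_def\<close>)+
    then have ge3: "3 \<le> card S1" "3 \<le> card S2" using xy ijS by auto
    \<comment> \<open>A diagonal that does not cross the cut is the cut itself or remains a diagonal
      of one half.\<close>
    have split: "(u, v) = (i, j) \<or> (u, v) \<in> diagonals S1 \<or> (u, v) \<in> diagonals S2"
      if uv: "(u, v) \<in> diagonals S" "\<not> crosses i j u v" for u v
    proof -
      have uvS: "u \<in> S" "v \<in> S" "u < v" using uv by (auto simp: diagonals_def)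
      obtain x' y' where x'y': "x' \<in> S" "u < x'" "x' < v" "y' \<in> S" "y' < u \<or> v < y'"
        using uv by (auto simp: diagonals_def)
      have "(u, v) = (i, j) \<or> (i \<le> u \<and> v \<le> j \<and> (i < u \<or> v < j)) \<or> v \<le> i \<or> j \<le> u
          \<or> (u \<le> i \<and> j \<le> v \<and> (u < i \<or> j < v))"
        using uv(2) ijS uvS unfolding crosses_def by auto
      then consider "(u, v) = (i, j)" | "i \<le> u" "v \<le> j" "i < u \<or> v < j" | "v \<le> i" | "j \<le> u"
          | "u \<le> i" "j \<le> v" "u < i \<or> j < v" by blast
      then show ?thesis
      proof cases
        case 2
        then have "(u, v) \<in> diagonals S1"
          using uvS x'y' ijS unfolding diagonals_def S1_def
          by (auto intro!: bexI[of _ x'])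
        then show ?thesis by simp
      next
        case 3
        then have "(u, v) \<in> diagonals S2"
          using uvS x'y' ijS unfolding diagonals_def S2_def
          by (auto intro!: bexI[of _ x'] bexI[of _ j])
        then show ?thesis by simp
      next
        case 4
        then have "(u, v) \<in> diagonals S2"
          using uvS x'y' ijS unfolding diagonals_def S2_def
          by (auto intro!: bexI[of _ x'] bexI[of _ i])
        then show ?thesis by simp
      next
        case 5
        \<comment> \<open>The vertex strictly between is \<open>i\<close> or \<open>j\<close>, since
          the pair differs from the cut.\<close>
        then have "\<exists>z\<in>S2. u < z \<and> z < v" "y' \<in> S2"
          using uvS x'y' ijS unfolding S2_def by auto
        then have "(u, v) \<in> diagonals S2"
          using 5 uvS x'y' ijS unfolding diagonals_def S2_def by blast
        then show ?thesis by simp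
      qed simp
    qed
    have "D = insert (i, j) (D1 \<union> D2)"
      using split less.prems(3,4) ij unfolding D1_def D2_def by fastforce
    moreover have "(i, j) \<notin> D1 \<union> D2" "D1 \<inter> D2 = {}"
      using ijS unfolding D1_def D2_def diagonals_def S1_def S2_def by auto
    moreover have "finite D1" "finite D2" using finD by (auto simp: D1_def D2_def)
    ultimately have cD: "card D = 1 + card D1 + card D2"
      by (simp add: card_Un_disjoint)
    have nc: "\<And>a b c d. (a, b) \<in> D1 \<Longrightarrow> (c, d) \<in> D1 \<Longrightarrow> \<not> crosses a b c d"
      "\<And>a b c d. (a, b) \<in> D2 \<Longrightarrow> (c, d) \<in> D2 \<Longrightarrow> \<not> crosses a b c d"
      using less.prems(4) unfolding D1_def D2_def by blast+
    have sub: "S1 \<subseteq> {..<n}" "S2 \<subseteq> {..<n}" "S1 \<subseteq> S" "S2 \<subseteq> S"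
      using less.prems(1) by (auto simp: S1_def S2_def)
    have lt: "card S1 < card S" "card S2 < card S" using cS ge3 by linarith+
    have D12: "D1 \<subseteq> diagonals S1" "D2 \<subseteq> diagonals S2" by (auto simp: D1_def D2_def)
    have IH1: "card D1 + 3 \<le> card S1 \<and>
      (card D1 + 3 = card S1 \<longrightarrow> convex_weights p S1 a v \<longrightarrow>
        (\<exists>i j k w'. i < j \<and> j < k \<and> {i, j, k} \<subseteq> S1 \<and> convex_weights p {i, j, k} a w' \<and>
           {(i, j), (j, k), (i, k)} \<inter> diagonals S1 \<subseteq> D1))" for v
      by (rule less.hyps[OF lt(1) sub(1) ge3(1) D12(1)]) (rule nc(1))
    have IH2: "card D2 + 3 \<le> card S2 \<and>
      (card D2 + 3 = card S2 \<longrightarrow> convex_weights p S2 a v \<longrightarrow>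
        (\<exists>i j k w'. i < j \<and> j < k \<and> {i, j, k} \<subseteq> S2 \<and> convex_weights p {i, j, k} a w' \<and>
           {(i, j), (j, k), (i, k)} \<inter> diagonals S2 \<subseteq> D2))" for v
      by (rule less.hyps[OF lt(2) sub(2) ge3(2) D12(2)]) (rule nc(2))
    have le: "card D1 + 3 \<le> card S1" "card D2 + 3 \<le> card S2"
      using IH1 IH2 by blast+
    have "\<exists>i j k w'. i < j \<and> j < k \<and> {i, j, k} \<subseteq> S \<and> convex_weights p {i, j, k} a w' \<and>
         {(i, j), (j, k), (i, k)} \<inter> diagonals S \<subseteq> D"
      if c: "card D + 3 = card S" and w: "convex_weights p S a w"
    proof -
      \<comment> \<open>By \<open>cD\<close> and \<open>cS\<close>, the two bounds in
        \<open>le\<close> add up to an equality, so each is tight.\<close>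
      have eq: "card D1 + 3 = card S1" "card D2 + 3 = card S2" using c le cD cS by linarith+
      \<comment> \<open>The cut is a side of each half but a diagonal of \<open>S\<close>, so the
        induction hypothesis says nothing about a triangle side lying on it; that side is in
        \<open>D\<close> by the choice of the cut.\<close>
      have lift: "(u, v) \<in> D"
        if "(u, v) \<in> diagonals S" "T = S1 \<or> T = S2" "u \<in> T" "v \<in> T" "(u, v) \<in> diagonals T \<longrightarrow> (u, v) \<in> D"
        for u v T
      proof -
        have uv: "u < v" using that(1) by (auto simp: diagonals_def)
        have "\<not> crosses i j u v"
          using that(2-4) uv ijS by (auto simp: crosses_def S1_def S2_def)
        from split[OF that(1) this] have "(u, v) = (i, j) \<or> (u, v) \<in> diagonals T"
        proof (elim disjE)
          assume "(u, v) \<in> diagonals S1"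
          then have "u \<in> S1" "v \<in> S1" by (auto simp: diagonals_def)
          then have "(u, v) = (i, j) \<or> T = S1" using that(2-4) uv by (auto simp: S1_def S2_def)
          then show ?thesis using \<open>(u, v) \<in> diagonals S1\<close> by blast
        next
          assume "(u, v) \<in> diagonals S2"
          then have "u \<in> S2" "v \<in> S2" by (auto simp: diagonals_def)
          then have "(u, v) = (i, j) \<or> T = S2" using that(2-4) uv by (auto simp: S1_def S2_def)
          then show ?thesis using \<open>(u, v) \<in> diagonals S2\<close> by blast
        qed simp
        then show ?thesis using that(5) ij by auto
      qed
      obtain w' where "convex_weights p S1 a w' \<or> convex_weights p S2 a w'"
        using convex_weights_split[OF poly less.prems(1) ijS w] unfolding S1_def S2_def by blast
      then have "\<exists>T. (T = S1 \<or> T = S2) \<and>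
        (\<exists>i j k w'. i < j \<and> j < k \<and> {i, j, k} \<subseteq> T \<and> convex_weights p {i, j, k} a w' \<and>
          {(i, j), (j, k), (i, k)} \<inter> diagonals T \<subseteq> D \<inter> diagonals T)"
      proof
        assume "convex_weights p S1 a w'"
        then have "(\<exists>i j k w'. i < j \<and> j < k \<and> {i, j, k} \<subseteq> S1 \<and> convex_weights p {i, j, k} a w' \<and>
          {(i, j), (j, k), (i, k)} \<inter> diagonals S1 \<subseteq> D \<inter> diagonals S1)"
          unfolding D1_def[symmetric] by (rule IH1[THEN conjunct2, THEN mp, THEN mp, OF eq(1)])
        then show ?thesis by (rule exI[of _ S1, OF conjI, OF disjI1, OF refl])
      next
        assume "convex_weights p S2 a w'"
        then have "(\<exists>i j k w'. i < j \<and> j < k \<and> {i, j, k} \<subseteq> S2 \<and> convex_weights p {i, j, k} a w' \<and>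
          {(i, j), (j, k), (i, k)} \<inter> diagonals S2 \<subseteq> D \<inter> diagonals S2)"
          unfolding D2_def[symmetric] by (rule IH2[THEN conjunct2, THEN mp, THEN mp, OF eq(2)])
        then show ?thesis by (rule exI[of _ S2, OF conjI, OF disjI2, OF refl])
      qed
      then obtain i' j' k' w'' T where T: "T = S1 \<or> T = S2" and t: "i' < j'" "j' < k'" "{i', j', k'} \<subseteq> T"
        "convex_weights p {i', j', k'} a w''" "{(i', j'), (j', k'), (i', k')} \<inter> diagonals T \<subseteq> D \<inter> diagonals T"
        by (elim exE conjE) (rule that)
      have "{(i', j'), (j', k'), (i', k')} \<inter> diagonals S \<subseteq> D"
        using lift[OF _ T] t(3,5) by auto
      moreover have "{i', j', k'} \<subseteq> S" using T t(3) sub by blast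
      ultimately show ?thesis using t by blast
    qed
    moreover have "card D + 3 \<le> card S" using le cD cS by linarith
    ultimately show ?thesis by blast
  qed
qed


section \<open>Triangles meet in common faces\<close>

text \<open>With \<open>q\<close> and \<open>r\<close> fixed, \<open>area\<close> is affine in its
  last argument; the constant term \<open>C\<close> is preserved because the weights sum to
  1.\<close>

lemma area_convex_weights:
  assumes "convex_weights p S x w"
  shows "area q r x = (\<Sum>s\<in>S. w s * area q r (p s))"
proof -
  define A B C where "A = (snd q - snd r) / 2" and "B = (fst r - fst q) / 2"
    and "C = (fst q * snd r - snd q * fst r) / 2"
  have lin: "area q r y = A * fst y + B * snd y + C" for y
    by (simp add: area_def A_def B_def C_def field_simps)
  have x: "sum w S = 1" "x = (\<Sum>s\<in>S. w s *\<^sub>R p s)" using assms by (auto simp: convex_weights_def)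
  have "(\<Sum>s\<in>S. w s * area q r (p s)) =
      A * (\<Sum>s\<in>S. w s * fst (p s)) + B * (\<Sum>s\<in>S. w s * snd (p s)) + C * sum w S"
    unfolding lin sum_distrib_left sum.distrib[symmetric] by (intro sum.cong) (auto simp: algebra_simps)
  also have "\<dots> = area q r x"
    unfolding lin by (simp add: x fst_sum snd_sum)
  finally show ?thesis ..
qed

text \<open>Expanding \<open>area\<close> over the weights leaves one term, as the other two repeat
  a point. Hence weights on a triangle are unique and given by \<open>bary\<close>.\<close>

lemma bary_eq_convex_weights:
  assumes poly: "convex_polygon p n" and ijk: "i < j" "j < k" "k < n"
    and w: "convex_weights p {i, j, k} x w"
  shows "bary p {i, j, k} v x = w v"
proof -
  have l: "sorted_list_of_set {i, j, k} = [i, j, k]"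
    using sorted_list_of_set.idem_if_sorted_distinct[of "[i, j, k]"] ijk by simp
  define D where "D = area (p i) (p j) (p k)"
  have D: "D > 0" using convex_polygonD[OF poly ijk] by (simp add: D_def)
  \<comment> \<open>\<open>bary\<close> has \<open>x\<close> in the middle slot, which causes the
    sign.\<close>
  have eq: "area q x r = - (w i * area q r (p i) + w j * area q r (p j) + w k * area q r (p k))" for q r
    using area_convex_weights[OF w, of q r] area_swap[of q r x] ijk by simp
  have "area (p k) x (p j) = w i * D" "area (p i) x (p k) = w j * D" "area (p j) x (p i) = w k * D"
    unfolding eq D_def by (simp_all add: area_def field_simps)
  moreover have "w v = 0" if "v \<notin> {i, j, k}" using w that by (auto simp: convex_weights_def)
  ultimately show ?thesis
    using D ijk by (auto simp: bary_def l Let_def D_def[symmetric])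
qed

text \<open>The line through \<open>p a\<close> and \<open>p b\<close> separates the two vertex
  sets, so a common point lies on it and all weight off \<open>a\<close> and \<open>b\<close>
  vanishes. Weights on two distinct points are determined by the point they represent.\<close>

lemma convex_weights_separated_eq:
  assumes poly: "convex_polygon p n" and ab: "a < b" "b < n" and "A \<subseteq> {..<n}" "B \<subseteq> {..<n}"
    and A: "\<And>s. s \<in> A \<Longrightarrow> a \<le> s \<and> s \<le> b" and B: "\<And>s. s \<in> B \<Longrightarrow> s \<le> a \<or> b \<le> s"
    and w: "convex_weights p A x w" and w': "convex_weights p B x w'"
  shows "w = w'"
proof -
  let ?g = "\<lambda>s. area (p a) (p b) (p s)"
  have fin: "finite A" "finite B" using assms(4,5) finite_subset by blast+
  have nn: "0 \<le> w s" "0 \<le> w' s" for s using w w' by (auto simp: convex_weights_def)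
  have gA: "?g s < 0" if "s \<in> A" "s \<noteq> a" "s \<noteq> b" for s
    using A[OF that(1)] that convex_polygonD[OF poly, of a s b] ab area_swap[of "p a" "p b" "p s"]
    by auto
  have gB: "0 < ?g s" if "s \<in> B" "s \<noteq> a" "s \<noteq> b" for s
  proof (cases "s < a")
    case True
    then show ?thesis
      using convex_polygonD[OF poly, of s a b] ab by (simp add: area_def field_simps)
  next
    case False
    then show ?thesis
      using convex_polygonD[OF poly, of a b s] B[OF that(1)] that ab assms(5) by fastforce
  qed
  have g0: "?g a = 0" "?g b = 0" by (simp_all add: area_def)
  have tA: "0 \<le> w s * - ?g s" if "s \<in> A" for s
    using gA[OF that] g0 nn(1)[of s] by (cases "s = a \<or> s = b") (auto simp: mult_nonneg_nonpos)
  have tB: "0 \<le> w' s * ?g s" if "s \<in> B" for s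
    using gB[OF that] g0 nn(2)[of s] by (cases "s = a \<or> s = b") auto
  \<comment> \<open>The two sums are opposite numbers and both nonnegative, so every summand is
    zero.\<close>
  have "(\<Sum>s\<in>A. w s * - ?g s) = - area (p a) (p b) x" "(\<Sum>s\<in>B. w' s * ?g s) = area (p a) (p b) x"
    using area_convex_weights[OF w] area_convex_weights[OF w'] by (simp_all add: sum_negf)
  moreover have "0 \<le> (\<Sum>s\<in>A. w s * - ?g s)" "0 \<le> (\<Sum>s\<in>B. w' s * ?g s)"
    using tA tB by (auto intro!: sum_nonneg simp del: mult_minus_right)
  ultimately have "(\<Sum>s\<in>A. w s * - ?g s) = 0" "(\<Sum>s\<in>B. w' s * ?g s) = 0" by linarith+
  then have "\<forall>s\<in>A. w s * - ?g s = 0" "\<forall>s\<in>B. w' s * ?g s = 0"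
    using sum_nonneg_eq_0_iff[OF fin(1), of "\<lambda>s. w s * - ?g s"] sum_nonneg_eq_0_iff[OF fin(2), of "\<lambda>s. w' s * ?g s"]
      tA tB by blast+
  note z = this
  have w0: "w s = 0" if "s \<notin> {a, b}" for s
    using z(1) gA[of s] that w by (cases "s \<in> A") (auto simp: convex_weights_def)
  have w'0: "w' s = 0" if "s \<notin> {a, b}" for s
    using z(2) gB[of s] that w' by (cases "s \<in> B") (auto simp: convex_weights_def)
  \<comment> \<open>\<open>A\<close> may fail to contain \<open>a\<close> or \<open>b\<close>, so it
    is enlarged before restricting.\<close>
  have "convex_weights p {a, b} x w"
    by (rule convex_weights_restrict[OF convex_weights_mono[OF w, of "A \<union> {a, b}"]]) (use fin w0 in auto)
  then have 1: "w a + w b = 1" "w a *\<^sub>R p a + w b *\<^sub>R p b = x"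
    using ab by (auto simp: convex_weights_def)
  have "convex_weights p {a, b} x w'"
    by (rule convex_weights_restrict[OF convex_weights_mono[OF w', of "B \<union> {a, b}"]]) (use fin w'0 in auto)
  then have 2: "w' a + w' b = 1" "w' a *\<^sub>R p a + w' b *\<^sub>R p b = x"
    using ab by (auto simp: convex_weights_def)
  have wb: "w b = 1 - w a" "w' b = 1 - w' a" using 1 2 by auto
  have "(w a - w' a) *\<^sub>R (p a - p b) =
      (w a *\<^sub>R p a + (1 - w a) *\<^sub>R p b) - (w' a *\<^sub>R p a + (1 - w' a) *\<^sub>R p b)"
    by (simp add: algebra_simps)
  then have "(w a - w' a) *\<^sub>R (p a - p b) = 0" using 1(2) 2(2) unfolding wb by simp
  moreover have "p a \<noteq> p b"
    using convex_polygon_inj[OF poly] ab by (auto dest: inj_onD)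
  ultimately have "w a = w' a" by simp
  moreover have "w b = w' b" using 1 2 calculation by simp
  ultimately show ?thesis using w0 w'0 by (metis empty_iff ext insert_iff)
qed

section \<open>Relative position of non-crossing triangles\<close>

lemma crosses_commute: "crosses a b c d \<longleftrightarrow> crosses c d a b"
  unfolding crosses_def min_def max_def by auto

lemma cyc_adj_iff:
  assumes "i < n" "j < n"
  shows "cyc_adj n i j \<longleftrightarrow> j = i + 1 \<or> i = j + 1 \<or> (i + 1 = n \<and> j = 0) \<or> (j + 1 = n \<and> i = 0)"
proof -
  have "(k + 1) mod n = (if k + 1 = n then 0 else k + 1)" if "k < n" for k
    using that by auto
  then show ?thesis using assms unfolding cyc_adj_def by auto
qed

text \<open>No index lies strictly between consecutive ones, and none lies outside the range from 0
  to n - 1.\<close>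

lemma edge_not_crosses:
  assumes "is_edge n {a, b}" "c < n" "d < n"
  shows "\<not> crosses a b c d"
proof -
  have "a < n" "b < n" "cyc_adj n a b"
    using assms(1) unfolding is_edge_def doubleton_eq_iff by (auto simp: cyc_adj_def)
  then show ?thesis
    using assms(2,3) by (auto simp: crosses_def cyc_adj_iff)
qed

lemma triangles_not_crosses:
  assumes \<delta>: "noncrossing_decomp n \<delta>" and t: "t \<in> triangles n \<delta>" "t' \<in> triangles n \<delta>"
    and ab: "a \<in> t" "b \<in> t" "a \<noteq> b" and cd: "c \<in> t'" "d \<in> t'" "c \<noteq> d"
  shows "\<not> crosses a b c d"
proof -
  have lt: "a < n" "b < n" "c < n" "d < n" using t ab cd by (auto simp: triangles_def)
  have "{a, b} \<subseteq> t" "card {a, b} = 2" "{c, d} \<subseteq> t'" "card {c, d} = 2" using ab cd by auto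
  then have "{a, b} \<in> \<delta> \<or> is_edge n {a, b}" "{c, d} \<in> \<delta> \<or> is_edge n {c, d}"
    using t unfolding triangles_def by blast+
  then show ?thesis
    using \<delta> edge_not_crosses[of n a b c d] edge_not_crosses[of n c d a b] lt
    unfolding noncrossing_decomp_def by (metis crosses_commute)
qed

text \<open>The vertices of the first triangle cut the cycle into three closed arcs. A second
  triangle that fits into none of them and is not equal to the first would have a side crossing one
  of its sides. The last disjunct is the arc that wraps around.\<close>

lemma noncrossing_triangles_position:
  assumes ijk: "i < j" "j < k" and xyz: "x < y" "y < z"
    and nc: "\<And>a b c d. a \<in> {i, j, k} \<Longrightarrow> b \<in> {i, j, k} \<Longrightarrow> a \<noteq> b \<Longrightarrow>
      c \<in> {x, y, z} \<Longrightarrow> d \<in> {x, y, z} \<Longrightarrow> c \<noteq> d \<Longrightarrow> \<not> crosses a b c d"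
  shows "(x = i \<and> y = j \<and> z = k) \<or> (i \<le> x \<and> z \<le> j) \<or> (j \<le> x \<and> z \<le> k) \<or>
    ((x \<le> i \<or> k \<le> x) \<and> (y \<le> i \<or> k \<le> y) \<and> (z \<le> i \<or> k \<le> z))"
proof -
  have "\<not> crosses i j x y" "\<not> crosses i j y z" "\<not> crosses i j x z"
    "\<not> crosses j k x y" "\<not> crosses j k y z" "\<not> crosses j k x z"
    "\<not> crosses i k x y" "\<not> crosses i k y z" "\<not> crosses i k x z"
    by (rule nc; use ijk xyz in simp)+
  moreover have "min i j = i" "max i j = j" "min j k = j" "max j k = k" "min i k = i" "max i k = k"
    using ijk by auto
  ultimately show ?thesis
    using ijk xyz unfolding crosses_def by (smt (verit) linorder_not_less nless_le order_less_trans)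
qed

lemma triangles_sorted:
  assumes "t \<in> triangles n \<delta>"
  obtains i j k where "t = {i, j, k}" "i < j" "j < k" "k < n"
proof -
  have t: "card t = 3" "t \<subseteq> {..<n}" using assms by (auto simp: triangles_def)
  obtain i j k where "t = {i, j, k}" "i < j" "j < k" using card_3_sorted[OF t(1)] by metis
  then show thesis using t(2) that[of i j k] by auto
qed

text \<open>This makes the barycentric coordinates of a point independent of the triangle containing
  it: distinct triangles are separated by a side of \<open>t\<close>.\<close>

lemma triangle_weights_unique:
  assumes poly: "convex_polygon p n" and \<delta>: "noncrossing_decomp n \<delta>"
    and t: "t \<in> triangles n \<delta>" "t' \<in> triangles n \<delta>"
    and w: "convex_weights p t a w" "convex_weights p t' a w'"
  shows "w = w'"
proof -
  obtain i j k where ijk: "t = {i, j, k}" "i < j" "j < k" "k < n" using triangles_sorted[OF t(1)] by metis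
  obtain x y z where xyz: "t' = {x, y, z}" "x < y" "y < z" "z < n" using triangles_sorted[OF t(2)] by metis
  have sub: "t \<subseteq> {..<n}" "t' \<subseteq> {..<n}" using ijk xyz by auto
  have "(x = i \<and> y = j \<and> z = k) \<or> (i \<le> x \<and> z \<le> j) \<or> (j \<le> x \<and> z \<le> k) \<or>
    ((x \<le> i \<or> k \<le> x) \<and> (y \<le> i \<or> k \<le> y) \<and> (z \<le> i \<or> k \<le> z))"
    by (rule noncrossing_triangles_position) (use ijk xyz triangles_not_crosses[OF \<delta> t] in auto)
  then consider "t = t'" | "i \<le> x" "z \<le> j" | "j \<le> x" "z \<le> k"
    | "(x \<le> i \<or> k \<le> x) \<and> (y \<le> i \<or> k \<le> y) \<and> (z \<le> i \<or> k \<le> z)"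
    using ijk xyz by blast
  then show ?thesis
  proof cases
    case 1
    then show ?thesis
      using bary_eq_convex_weights[OF poly ijk(2-4)] w ijk(1) by (metis ext)
  next
    \<comment> \<open>Here and in the next case \<open>t'\<close> lies between the ends of the
      separating side, so it takes the role of \<open>A\<close>; in the last case \<open>t\<close>
      does.\<close>
    case 2
    then have "w' = w"
      by (intro convex_weights_separated_eq[OF poly _ _ sub(2,1) _ _ w(2,1), of i j]) (use ijk xyz in auto)
    then show ?thesis ..
  next
    case 3
    then have "w' = w"
      by (intro convex_weights_separated_eq[OF poly _ _ sub(2,1) _ _ w(2,1), of j k]) (use ijk xyz in auto)
    then show ?thesis ..
  next
    case 4
    then show ?thesis
      by (intro convex_weights_separated_eq[OF poly _ _ sub _ _ w, of i k]) (use ijk xyz in auto)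
  qed
qed

text \<open>With n - 3 chords, \<open>\<delta>\<close> attains the bound of
  \<open>noncrossing_diagonals_cover\<close> on the full vertex set, so its equality case
  applies.\<close>

lemma triangles_cover:
  assumes poly: "convex_polygon p n" and \<delta>: "noncrossing_decomp n \<delta>" and a: "a \<in> polygon p n"
  obtains t w where "t \<in> triangles n \<delta>" "convex_weights p t a w"
proof -
  define D where "D = {(x, y). x < y \<and> {x, y} \<in> \<delta>}"
  have n3: "3 \<le> n" using poly by (simp add: convex_polygon_def)
  have chord: "x < n \<and> y < n \<and> x \<noteq> y \<and> \<not> cyc_adj n x y" if "{x, y} \<in> \<delta>" for x y
    using \<delta> that unfolding noncrossing_decomp_def is_chord_def by (fastforce simp: doubleton_eq_iff cyc_adj_def)
  have "bij_betw (\<lambda>(x, y). {x, y}) D \<delta>"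
    unfolding bij_betw_def
  proof
    show "inj_on (\<lambda>(x, y). {x, y}) D"
      by (auto simp: inj_on_def D_def doubleton_eq_iff)
    show "(\<lambda>(x, y). {x, y}) ` D = \<delta>"
    proof
      show "\<delta> \<subseteq> (\<lambda>(x, y). {x, y}) ` D"
      proof
        fix c assume c: "c \<in> \<delta>"
        then obtain x y where xy: "c = {x, y}" "x \<noteq> y"
          using \<delta> unfolding noncrossing_decomp_def is_chord_def by blast
        then have "c = {min x y, max x y}" "min x y < max x y" by (auto simp: min_def max_def)
        then show "c \<in> (\<lambda>(x, y). {x, y}) ` D"
          using c by (intro image_eqI[of _ _ "(min x y, max x y)"]) (auto simp: D_def)
      qed
    qed (auto simp: D_def)
  qed
  then have cD: "card D = n - 3" using \<delta> by (simp add: bij_betw_same_card noncrossing_decomp_def)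
  \<comment> \<open>For a non-adjacent pair, x + 1 lies strictly between, and 0 or y + 1 lies
    strictly outside.\<close>
  have Dd: "D \<subseteq> diagonals {..<n}"
  proof clarify
    fix x y assume "(x, y) \<in> D"
    then have xy: "x < y" "y < n" "\<not> cyc_adj n x y" using chord by (auto simp: D_def)
    then have ne: "y \<noteq> x + 1" "\<not> (y + 1 = n \<and> x = 0)" by (auto simp: cyc_adj_iff)
    have "x < x + 1 \<and> x + 1 < y" using xy ne by auto
    moreover have "0 < x \<or> y + 1 < n" using xy ne by auto
    then have "\<exists>z<n. z < x \<or> y < z" using xy by (metis less_add_one order_less_trans)
    ultimately show "(x, y) \<in> diagonals {..<n}"
      using xy unfolding diagonals_def by force
  qed
  have nc: "\<not> crosses x y z u" if "(x, y) \<in> D" "(z, u) \<in> D" for x y z u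
    using \<delta> that by (auto simp: D_def noncrossing_decomp_def)
  obtain w where "convex_weights p {..<n} a w"
    using a hull_iff_convex_weights[OF _ convex_polygon_inj[OF poly]] by (auto simp: polygon_def)
  then obtain i j k w' where ijk: "i < j" "j < k" "{i, j, k} \<subseteq> {..<n}" "convex_weights p {i, j, k} a w'"
      "{(i, j), (j, k), (i, k)} \<inter> diagonals {..<n} \<subseteq> D"
    using noncrossing_diagonals_cover[OF poly order_refl _ Dd nc, of a w] cD n3 by auto
  have edge: "{x, y} \<in> \<delta> \<or> is_edge n {x, y}"
    if xy: "(x, y) \<in> {(i, j), (j, k), (i, k)}" for x y
  proof (cases "(x, y) \<in> diagonals {..<n}")
    case True
    then show ?thesis using ijk(5) xy by (auto simp: D_def)
  next
    case False
    have lt: "x < y" "y < n" using xy ijk(1-3) by auto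
    have "y = x + 1 \<or> (x = 0 \<and> y + 1 = n)"
    proof (rule ccontr)
      assume "\<not> ?thesis"
      then have "x < x + 1 \<and> x + 1 < y" "0 < x \<or> y + 1 < n" using lt by auto
      moreover from this have "\<exists>z<n. z < x \<or> y < z" using lt by (metis less_add_one order_less_trans)
      ultimately have "(x, y) \<in> diagonals {..<n}" using lt unfolding diagonals_def by force
      then show False using False by simp
    qed
    then have "cyc_adj n x y" using lt by (auto simp: cyc_adj_iff)
    then have "is_edge n {x, y}"
      using lt unfolding is_edge_def by (intro exI[of _ x] exI[of _ y]) simp
    then show ?thesis ..
  qed
  have "e \<in> \<delta> \<or> is_edge n e" if e: "e \<subseteq> {i, j, k}" "card e = 2" for e
  proof -
    obtain x y where "e = {x, y}" "x \<noteq> y" using e(2) by (auto simp: card_2_iff)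
    then have "e = {i, j} \<or> e = {j, k} \<or> e = {i, k}" using e(1) by auto
    then show ?thesis using edge by auto
  qed
  then have "{i, j, k} \<in> triangles n \<delta>"
    using ijk(1-3) by (auto simp: triangles_def)
  then show thesis using ijk(4) that by blast
qed

section \<open>Collapse of the inclusion-exclusion recursion\<close>

text \<open>The first listed triangle containing \<open>x\<close> contributes \<open>b\<close> if
  \<open>x\<close> is not yet in \<open>U\<close>; from then on \<open>x\<close> belongs to the
  accumulated union and the two indicator terms cancel.\<close>

lemma chordF_eq:
  assumes "\<And>t. t \<in> set ts \<Longrightarrow> x \<in> tri p t \<Longrightarrow> bary p t v x = b"
  shows "chordF p v U ts x = (if x \<notin> U \<and> (\<exists>t\<in>set ts. x \<in> tri p t) then b else 0)"
  using assms
proof (induction ts arbitrary: U)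
  case (Cons t ts)
  have "chordF p v (U \<union> tri p t) ts x =
      (if x \<notin> U \<union> tri p t \<and> (\<exists>t\<in>set ts. x \<in> tri p t) then b else 0)"
    by (rule Cons.IH) (use Cons.prems in auto)
  then show ?case using Cons.prems[of t] by (auto simp: indicator_def)
qed simp

lemma chordal_coord_convex_weights:
  assumes poly: "convex_polygon p n" and \<delta>: "noncrossing_decomp n \<delta>" and a: "a \<in> polygon p n"
  shows "convex_weights p {..<n} a (chordal_coord p n \<delta> a)"
proof -
  obtain t0 w where t0: "t0 \<in> triangles n \<delta>" "convex_weights p t0 a w"
    using triangles_cover[OF assms] by metis
  have tri_iff: "a \<in> tri p t \<longleftrightarrow> (\<exists>w. convex_weights p t a w)" if "t \<in> triangles n \<delta>" for t
  proof -
    have "t \<subseteq> {..<n}" using that by (auto simp: triangles_def)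
    then show ?thesis unfolding tri_def
      using convex_polygon_inj[OF poly] by (meson hull_iff_convex_weights finite_lessThan finite_subset inj_on_subset)
  qed
  have bary: "bary p t v a = w v" if t: "t \<in> triangles n \<delta>" "a \<in> tri p t" for t v
  proof -
    obtain w' where w': "convex_weights p t a w'" using tri_iff[OF t(1)] t(2) by blast
    obtain i j k where "t = {i, j, k}" "i < j" "j < k" "k < n" using triangles_sorted[OF t(1)] by metis
    then have "bary p t v a = w' v" using bary_eq_convex_weights[OF poly] w' by blast
    moreover have "w' = w" using triangle_weights_unique[OF poly \<delta> t(1) t0(1) w' t0(2)] .
    ultimately show ?thesis by simp
  qed
  have "chordal_coord p n \<delta> a v = w v" for v
  proof -
    let ?T = "{t \<in> triangles n \<delta>. v \<in> t}"
    define ts where "ts = (SOME ts. distinct ts \<and> set ts = ?T)"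
    have "finite ?T" by (rule finite_subset[of _ "Pow {..<n}"]) (auto simp: triangles_def)
    then have "\<exists>ts. distinct ts \<and> set ts = ?T" using finite_distinct_list by blast
    \<comment> \<open>Finiteness provides an enumeration, and only its set of entries
      matters.\<close>
    then have ts: "set ts = ?T" unfolding ts_def by (rule someI2_ex) simp
    have "chordal_coord p n \<delta> a v = chordF p v {} ts a"
      by (simp add: chordal_coord_def ts_def Let_def)
    also have "\<dots> = (if a \<notin> {} \<and> (\<exists>t\<in>set ts. a \<in> tri p t) then w v else 0)"
      by (rule chordF_eq) (use bary ts in auto)
    also have "\<dots> = w v"
    \<comment> \<open>If \<open>v\<close> is in \<open>t0\<close>, then \<open>t0\<close> itself is
      a listed triangle containing \<open>a\<close>; otherwise both branches give 0.\<close>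
    proof (cases "v \<in> t0")
      case True
      then show ?thesis using ts t0 tri_iff by auto
    next
      case False
      then show ?thesis using t0(2) by (simp add: convex_weights_def)
    qed
    finally show ?thesis .
  qed
  then have "chordal_coord p n \<delta> a = w" by auto
  moreover have "convex_weights p {..<n} a w"
    using t0 by (intro convex_weights_mono[OF t0(2)]) (auto simp: triangles_def)
  ultimately show ?thesis by simp
qed

section \<open>The dihedral group\<close>

text \<open>The maps c + i and, next, c - i modulo \<open>n\<close>, where \<open>c\<close> is the
  image of 0. For indices below \<open>n\<close> a case split replaces \<open>mod\<close> and keeps
  goals within linear arithmetic.\<close>

definition rotation :: "nat \<Rightarrow> nat \<Rightarrow> nat \<Rightarrow> nat" where
  "rotation n c i = (if c + i < n then c + i else c + i - n)"

definition reflection :: "nat \<Rightarrow> nat \<Rightarrow> nat \<Rightarrow> nat" where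
  "reflection n c i = (if i \<le> c then c - i else c + n - i)"

text \<open>The value at 1 is one of the two neighbours of \<open>g 0\<close>. After that adjacency
  leaves two candidates for each value, and injectivity excludes the one just left.\<close>

lemma dihedral_cases:
  assumes n: "3 \<le> n" and g: "g \<in> dihedral n"
  obtains c where "c < n" "(\<forall>i<n. g i = rotation n c i) \<or> (\<forall>i<n. g i = reflection n c i)"
proof -
  have inj: "inj_on g {..<n}" and lt: "g i < n" if "i < n" for i
    using g that by (auto simp: dihedral_def bij_betw_def)
  have adj: "g (Suc i) = g i + 1 \<or> g i = g (Suc i) + 1 \<or> (g i + 1 = n \<and> g (Suc i) = 0) \<or>
      (g (Suc i) + 1 = n \<and> g i = 0)" if "Suc i < n" for i
  proof -
    have "cyc_adj n i (Suc i)" using that by (simp add: cyc_adj_def)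
    then have "cyc_adj n (g i) (g (Suc i))" using g that by (simp add: dihedral_def)
    then show ?thesis using cyc_adj_iff[OF lt lt, of i "Suc i"] that by auto
  qed
  have ne: "g (Suc (Suc i)) \<noteq> g i" if "Suc (Suc i) < n" for i
  proof
    assume "g (Suc (Suc i)) = g i"
    then have "Suc (Suc i) = i" using inj[of 0] that n by (auto dest!: inj_onD)
    then show False by simp
  qed
  have c: "g 0 < n" using lt n by simp
  have g1: "g 1 = rotation n (g 0) 1 \<or> g 1 = reflection n (g 0) 1"
    using adj[of 0] n c lt[of 1] by (auto simp: rotation_def reflection_def)
  then show thesis
  proof
    assume 1: "g 1 = rotation n (g 0) 1"
    \<comment> \<open>Two consecutive values are carried along, since the next value depends on
      both.\<close>
    have step: "Suc i < n \<Longrightarrow> g i = rotation n (g 0) i \<and> g (Suc i) = rotation n (g 0) (Suc i)" for i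
    proof (induction i)
      case (Suc i)
      then have IH: "g i = rotation n (g 0) i" "g (Suc i) = rotation n (g 0) (Suc i)" by auto
      show ?case
        using IH adj[of "Suc i"] ne[of i] Suc.prems c lt[of "Suc (Suc i)"]
        by (auto simp: rotation_def split: if_splits)
    qed (use 1 c in \<open>auto simp: rotation_def\<close>)
    have "g i = rotation n (g 0) i" if "i < n" for i
    proof (cases i)
      case 0
      then show ?thesis using c by (simp add: rotation_def)
    next
      case (Suc k)
      then show ?thesis using step[of k] that by blast
    qed
    then show thesis using that c by blast
  next
    assume 1: "g 1 = reflection n (g 0) 1"
    have step: "Suc i < n \<Longrightarrow> g i = reflection n (g 0) i \<and> g (Suc i) = reflection n (g 0) (Suc i)" for i
    proof (induction i)
      case (Suc i)
      then have IH: "g i = reflection n (g 0) i" "g (Suc i) = reflection n (g 0) (Suc i)" by auto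
      show ?case
        using IH adj[of "Suc i"] ne[of i] Suc.prems c lt[of "Suc (Suc i)"]
        by (auto simp: reflection_def split: if_splits)
    qed (use 1 c in \<open>auto simp: reflection_def\<close>)
    have "g i = reflection n (g 0) i" if "i < n" for i
    proof (cases i)
      case 0
      then show ?thesis using c by (simp add: reflection_def)
    next
      case (Suc k)
      then show ?thesis using step[of k] that by blast
    qed
    then show thesis using that c by blast
  qed
qed

lemma restrict_in_dihedral:
  assumes "inj_on f {..<n}" "\<And>i. i < n \<Longrightarrow> f i < n"
    "\<And>i j. i < n \<Longrightarrow> j < n \<Longrightarrow> cyc_adj n i j \<longleftrightarrow> cyc_adj n (f i) (f j)"
  shows "restrict f {..<n} \<in> dihedral n"
proof -
  have "f ` {..<n} = {..<n}"
    using assms(1,2) by (intro endo_inj_surj) auto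
  then have "bij_betw f {..<n} {..<n}" using assms(1) by (simp add: bij_betw_def)
  then have "bij_betw (restrict f {..<n}) {..<n} {..<n}"
    by (subst bij_betw_cong[of _ _ f]) auto
  then show ?thesis using assms(3) by (auto simp: dihedral_def)
qed

lemma rotation_in_dihedral: "c < n \<Longrightarrow> restrict (rotation n c) {..<n} \<in> dihedral n"
proof (rule restrict_in_dihedral)
  assume c: "c < n"
  show "inj_on (rotation n c) {..<n}"
    using c by (auto simp: inj_on_def rotation_def split: if_splits)
  show lt: "rotation n c i < n" if "i < n" for i using c that by (auto simp: rotation_def)
  show "cyc_adj n i j \<longleftrightarrow> cyc_adj n (rotation n c i) (rotation n c j)" if "i < n" "j < n" for i j
    unfolding cyc_adj_iff[OF that] cyc_adj_iff[OF lt[OF that(1)] lt[OF that(2)]]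
    using c that by (auto simp: rotation_def)
qed

lemma reflection_in_dihedral: "c < n \<Longrightarrow> restrict (reflection n c) {..<n} \<in> dihedral n"
proof (rule restrict_in_dihedral)
  assume c: "c < n"
  show "inj_on (reflection n c) {..<n}"
    using c by (auto simp: inj_on_def reflection_def split: if_splits)
  show lt: "reflection n c i < n" if "i < n" for i using c that by (auto simp: reflection_def)
  show "cyc_adj n i j \<longleftrightarrow> cyc_adj n (reflection n c i) (reflection n c j)" if "i < n" "j < n" for i j
    unfolding cyc_adj_iff[OF that] cyc_adj_iff[OF lt[OF that(1)] lt[OF that(2)]]
    using c that by (auto simp: reflection_def)
qed

text \<open>Extensionality makes each group element equal to a restricted rotation or reflection.
  The value at 0 recovers \<open>c\<close>, and the value at 1 tells the two families apart because
  c + 1 and c - 1 differ modulo \<open>n\<close>.\<close>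

lemma card_dihedral:
  assumes n: "3 \<le> n"
  shows "card (dihedral n) = 2 * n"
proof -
  let ?R = "(\<lambda>c. restrict (rotation n c) {..<n}) ` {..<n}"
  let ?F = "(\<lambda>c. restrict (reflection n c) {..<n}) ` {..<n}"
  have at0: "restrict (rotation n c) {..<n} 0 = c" "restrict (reflection n c) {..<n} 0 = c"
    if "c < n" for c using that by (auto simp: rotation_def reflection_def)
  have at1: "restrict (rotation n c) {..<n} 1 \<noteq> restrict (reflection n c) {..<n} 1" if "c < n" for c
    using that n by (auto simp: rotation_def reflection_def)
  have inj: "inj_on (\<lambda>c. restrict (rotation n c) {..<n}) {..<n}"
    "inj_on (\<lambda>c. restrict (reflection n c) {..<n}) {..<n}"
    by (rule inj_onI, metis at0 lessThan_iff)+
  have disj: "?R \<inter> ?F = {}"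
  proof (rule ccontr)
    assume "?R \<inter> ?F \<noteq> {}"
    then obtain c d where cd: "c < n" "d < n" "restrict (rotation n c) {..<n} = restrict (reflection n d) {..<n}"
      by auto
    then have "c = d" using at0 by metis
    then show False using at1 cd by metis
  qed
  have "dihedral n = ?R \<union> ?F"
  proof
    show "dihedral n \<subseteq> ?R \<union> ?F"
    proof
      fix g assume g: "g \<in> dihedral n"
      have ext: "g = restrict f {..<n}" if "\<forall>i<n. g i = f i" for f
        using g that by (intro extensionalityI[of _ "{..<n}"]) (auto simp: dihedral_def)
      obtain c where "c < n" "(\<forall>i<n. g i = rotation n c i) \<or> (\<forall>i<n. g i = reflection n c i)"
        using dihedral_cases[OF n g] by metis
      then show "g \<in> ?R \<union> ?F" using ext by blast
    qed
    show "?R \<union> ?F \<subseteq> dihedral n" using rotation_in_dihedral reflection_in_dihedral by auto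
  qed
  then have "card (dihedral n) = card ?R + card ?F"
    using disj by (simp add: card_Un_disjoint)
  then show ?thesis using inj by (simp add: card_image)
qed

section \<open>Cyclic order and crossings under dihedral maps\<close>

text \<open>Unlike \<open>crosses\<close>, this does not single out the break between n - 1 and 0.
  Chords cross exactly when their endpoints alternate in this order.\<close>

definition cyclic :: "nat \<Rightarrow> nat \<Rightarrow> nat \<Rightarrow> nat \<Rightarrow> bool" where
  "cyclic a b c d \<longleftrightarrow> (a < b \<and> b < c \<and> c < d) \<or> (b < c \<and> c < d \<and> d < a) \<or>
     (c < d \<and> d < a \<and> a < b) \<or> (d < a \<and> a < b \<and> b < c)"

lemma crosses_iff_cyclic: "crosses a b c d \<longleftrightarrow> cyclic a c b d \<or> cyclic a d b c"
  unfolding crosses_def cyclic_def by (cases "a \<le> b") (auto simp: min_def max_def)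

text \<open>A rotation is increasing on each of two blocks, the wrapped indices and the others, and
  exchanges the blocks. Pulling back an increasing chain thus gives a chain up to a cyclic
  shift.\<close>

lemma cyclic_rotation:
  assumes lt: "c < n" "x < n" "y < n" "z < n" "u < n"
    and "cyclic (rotation n c x) (rotation n c y) (rotation n c z) (rotation n c u)"
  shows "cyclic x y z u"
proof -
  have less: "(c + v < n) = (c + w < n) \<and> v < w \<or> n \<le> c + v \<and> c + w < n"
    if "rotation n c v < rotation n c w" "v < n" "w < n" for v w
    using that lt(1) unfolding rotation_def by (auto split: if_splits)
  \<comment> \<open>One of the four starting points of \<open>cyclic\<close>; the others follow by
    shifting the arguments.\<close>
  have "cyclic x y z u" if "rotation n c x < rotation n c y" "rotation n c y < rotation n c z"
    "rotation n c z < rotation n c u" "x < n" "y < n" "z < n" "u < n" for x y z u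
    using less[OF that(1,4,5)] less[OF that(2,5,6)] less[OF that(3,6,7)] unfolding cyclic_def
    by linarith
  note * = this
  show ?thesis
    using assms(6) *[OF _ _ _ lt(2-5)] *[OF _ _ _ lt(3,4,5,2)] *[OF _ _ _ lt(4,5,2,3)] *[OF _ _ _ lt(5,2,3,4)]
    unfolding cyclic_def by blast
qed

text \<open>A reflection is decreasing on each of the blocks up to \<open>c\<close> and beyond
  \<open>c\<close>, so it reverses the cyclic order.\<close>

lemma cyclic_reflection:
  assumes lt: "c < n" "x < n" "y < n" "z < n" "u < n"
    and "cyclic (reflection n c x) (reflection n c y) (reflection n c z) (reflection n c u)"
  shows "cyclic u z y x"
proof -
  have less: "(v \<le> c) = (w \<le> c) \<and> w < v \<or> v \<le> c \<and> c < w"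
    if "reflection n c v < reflection n c w" "v < n" "w < n" for v w
    using that lt(1) unfolding reflection_def by (simp split: if_splits)
  have "cyclic u z y x" if "reflection n c x < reflection n c y" "reflection n c y < reflection n c z"
    "reflection n c z < reflection n c u" "x < n" "y < n" "z < n" "u < n" for x y z u
    using less[OF that(1,4,5)] less[OF that(2,5,6)] less[OF that(3,6,7)] unfolding cyclic_def
    by linarith
  note * = this
  show ?thesis
    using assms(6) *[OF _ _ _ lt(2-5)] *[OF _ _ _ lt(3,4,5,2)] *[OF _ _ _ lt(4,5,2,3)] *[OF _ _ _ lt(5,2,3,4)]
    unfolding cyclic_def by blast
qed

lemma rotation_crosses:
  assumes "c < n" "x < n" "y < n" "z < n" "u < n"
    "crosses (rotation n c x) (rotation n c y) (rotation n c z) (rotation n c u)"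
  shows "crosses x y z u"
  using assms cyclic_rotation unfolding crosses_iff_cyclic by blast

lemma reflection_crosses:
  assumes "c < n" "x < n" "y < n" "z < n" "u < n"
    "crosses (reflection n c x) (reflection n c y) (reflection n c z) (reflection n c u)"
  shows "crosses x y z u"
proof -
  have "cyclic u y z x \<or> cyclic z y u x"
    using assms cyclic_reflection unfolding crosses_iff_cyclic by blast
  then show ?thesis unfolding crosses_iff_cyclic cyclic_def by blast
qed

lemma dihedral_crosses:
  assumes "3 \<le> n" "g \<in> dihedral n" "x < n" "y < n" "z < n" "u < n" "crosses (g x) (g y) (g z) (g u)"
  shows "crosses x y z u"
proof -
  obtain c where c: "c < n" "(\<forall>i<n. g i = rotation n c i) \<or> (\<forall>i<n. g i = reflection n c i)"
    using dihedral_cases[OF assms(1,2)] by metis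
  from c(2) show ?thesis
  proof
    assume "\<forall>i<n. g i = rotation n c i"
    then have "crosses (rotation n c x) (rotation n c y) (rotation n c z) (rotation n c u)"
      using assms by simp
    then show ?thesis
      using rotation_crosses c(1) assms(3-6) by blast
  next
    assume "\<forall>i<n. g i = reflection n c i"
    then have "crosses (reflection n c x) (reflection n c y) (reflection n c z) (reflection n c u)"
      using assms by simp
    then show ?thesis
      using reflection_crosses c(1) assms(3-6) by blast
  qed
qed

text \<open>A crossing between image chords pulls back to one in \<open>\<delta>\<close>, and
  injectivity of \<open>g\<close> on vertices makes the action injective on chords.\<close>

lemma noncrossing_decomp_act:
  assumes n: "3 \<le> n" and g: "g \<in> dihedral n" and \<delta>: "noncrossing_decomp n \<delta>"
  shows "noncrossing_decomp n (act \<delta> g)"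
  unfolding noncrossing_decomp_def
proof (intro conjI ballI allI impI)
  have inj: "inj_on g {..<n}" and lt: "g i < n" if "i < n" for i
    using g that by (auto simp: dihedral_def bij_betw_def)
  have chord: "\<exists>i j. c = {i, j} \<and> i < n \<and> j < n \<and> i \<noteq> j \<and> \<not> cyc_adj n i j" if "c \<in> \<delta>" for c
    using that \<delta> by (auto simp: noncrossing_decomp_def is_chord_def)
  show "is_chord n c" if c: "c \<in> act \<delta> g" for c
  proof -
    obtain d where d: "d \<in> \<delta>" "c = g ` d" using c by (auto simp: act_def)
    obtain i j where ij: "d = {i, j}" "i < n" "j < n" "i \<noteq> j" "\<not> cyc_adj n i j"
      using chord[OF d(1)] by blast
    then have "g i \<noteq> g j" "\<not> cyc_adj n (g i) (g j)"
      using inj[OF ij(2)] g by (auto dest: inj_onD simp: dihedral_def)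
    moreover have "c = {g i, g j}" "g i < n" "g j < n" using ij d(2) lt by simp_all
    ultimately show ?thesis unfolding is_chord_def by blast
  qed
  show "finite (act \<delta> g)" using \<delta> by (simp add: act_def noncrossing_decomp_def)
  have "\<delta> \<subseteq> Pow {..<n}" using chord by fastforce
  then have "inj_on (image g) \<delta>"
    using inj_on_image_Pow[OF inj[of 0]] n inj_on_subset by fastforce
  then show "card (act \<delta> g) = n - 3"
    using \<delta> by (simp add: act_def card_image noncrossing_decomp_def)
  \<comment> \<open>The preimage chord is written with its endpoints in the order of
    \<open>x\<close> and \<open>y\<close>, as \<open>dihedral_crosses\<close> expects.\<close>
  have pre: "\<exists>i j. {i, j} \<in> \<delta> \<and> i < n \<and> j < n \<and> x = g i \<and> y = g j" if xy: "{x, y} \<in> act \<delta> g" for x y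
  proof -
    obtain d where d: "d \<in> \<delta>" "{x, y} = g ` d" using xy unfolding act_def by (elim imageE)
    obtain i j where ij: "d = {i, j}" "i < n" "j < n" using chord[OF d(1)] by blast
    then have "x = g i \<and> y = g j \<or> x = g j \<and> y = g i" using d(2) by (auto simp: doubleton_eq_iff)
    moreover have "{i, j} \<in> \<delta>" "{j, i} \<in> \<delta>" using d(1) ij(1) by (simp_all add: insert_commute)
    ultimately show ?thesis using ij by blast
  qed
  show "\<not> crosses x y z u" if xyzu: "{x, y} \<in> act \<delta> g \<and> {z, u} \<in> act \<delta> g" for x y z u
  proof
    assume c: "crosses x y z u"
    obtain i j where ij: "{i, j} \<in> \<delta>" "i < n" "j < n" "x = g i" "y = g j" using pre xyzu by blast
    obtain k l where kl: "{k, l} \<in> \<delta>" "k < n" "l < n" "z = g k" "u = g l" using pre xyzu by blast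
    have "crosses i j k l" using dihedral_crosses[OF n g] ij kl c by blast
    then show False using \<delta> ij kl unfolding noncrossing_decomp_def by blast
  qed
qed

section \<open>Averaging over the group\<close>

text \<open>The weights representing a fixed point form a convex set; exchanging the sums over
  vertices and over \<open>G\<close> shows this for the uniform average.\<close>

lemma convex_weights_average:
  assumes "finite G" "G \<noteq> {}" "finite S" "\<And>g. g \<in> G \<Longrightarrow> convex_weights p S a (W g)"
  shows "convex_weights p S a (\<lambda>v. (\<Sum>g\<in>G. W g v) / real (card G))"
  unfolding convex_weights_def
proof (intro conjI allI impI)
  have card: "real (card G) \<noteq> 0" using assms by simp
  show "0 \<le> (\<Sum>g\<in>G. W g v) / real (card G)" for v
    using assms(4) by (intro divide_nonneg_nonneg sum_nonneg) (auto simp: convex_weights_def)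
  show "(\<Sum>g\<in>G. W g v) / real (card G) = 0" if "v \<notin> S" for v
    using assms(4) that by (simp add: convex_weights_def)
  have "(\<Sum>v\<in>S. \<Sum>g\<in>G. W g v) = real (card G)"
    using assms(4) by (subst sum.swap) (simp add: convex_weights_def)
  then show "(\<Sum>v\<in>S. (\<Sum>g\<in>G. W g v) / real (card G)) = 1"
    using card by (simp add: sum_divide_distrib[symmetric])
  have "(\<Sum>v\<in>S. ((\<Sum>g\<in>G. W g v) / real (card G)) *\<^sub>R p v) =
      (1 / real (card G)) *\<^sub>R (\<Sum>v\<in>S. \<Sum>g\<in>G. W g v *\<^sub>R p v)"
    by (simp add: scaleR_sum_right scaleR_sum_left[symmetric] divide_inverse mult.commute)
  also have "(\<Sum>v\<in>S. \<Sum>g\<in>G. W g v *\<^sub>R p v) = real (card G) *\<^sub>R a"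
    using assms(4) by (subst sum.swap) (simp add: convex_weights_def sum_constant_scaleR)
  finally show "(\<Sum>v\<in>S. ((\<Sum>g\<in>G. W g v) / real (card G)) *\<^sub>R p v) = a" using card by simp
qed

theorem theorem7p17:
  fixes p :: "nat \<Rightarrow> real \<times> real" and n :: nat and \<delta> :: "nat set set"
  assumes "3 \<le> n"
    and "convex_polygon p n"
    and "chordal_decomp p n \<delta>"
  shows "\<forall>a \<in> polygon p n.
           (\<forall>v<n. 0 \<le> kappa p n \<delta> a v \<and> kappa p n \<delta> a v \<le> 1)
         \<and> (\<Sum>v<n. kappa p n \<delta> a v) = 1
         \<and> a = (\<Sum>v<n. kappa p n \<delta> a v *\<^sub>R p v)"
proof
  fix a assume a: "a \<in> polygon p n"
  have card: "card (dihedral n) = 2 * n" using card_dihedral assms(1) by blast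
  then have fin: "finite (dihedral n)" "dihedral n \<noteq> {}"
    using assms(1) by (auto intro: card_ge_0_finite)
  \<comment> \<open>The factor in \<open>kappa\<close> is the reciprocal of the group order, so
    \<open>kappa\<close> is a genuine average.\<close>
  have "kappa p n \<delta> a = (\<lambda>v. (\<Sum>g\<in>dihedral n. chordal_coord p n (act \<delta> g) a v) / real (card (dihedral n)))"
    by (auto simp: kappa_def card)
  moreover have "convex_weights p {..<n} a \<dots>"
    by (rule convex_weights_average[OF fin finite_lessThan])
       (use chordal_coord_convex_weights[OF assms(2) noncrossing_decomp_act[OF assms(1) _
          noncrossing_decomp_if_chordal_decomp[OF assms(2,3)]] a] in auto)
  ultimately have w: "convex_weights p {..<n} a (kappa p n \<delta> a)" by simp
  show "(\<forall>v<n. 0 \<le> kappa p n \<delta> a v \<and> kappa p n \<delta> a v \<le> 1)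
         \<and> (\<Sum>v<n. kappa p n \<delta> a v) = 1
         \<and> a = (\<Sum>v<n. kappa p n \<delta> a v *\<^sub>R p v)"
    using w convex_weights_le_1[OF w finite_lessThan] by (auto simp: convex_weights_def)
qed

end
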